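(* Let $c$ and $d$ be nonzero real numbers, let $a>-1$ be real, and let $0<j_1(a,c,d)<j_2(a,c,d)<\cdots$ be the positive zeros of $x\mapsto cJ_a(x)+dJ_{a+1}(x)$. Write $$\sigma = \frac{(2a+1)cd}{c^2+d^2}.$$ (i) If $a\ge\frac12$ and $c$ has the same sign as $d$, then for all $k\ge1$ $$j_{k+1}(a,c,d)-j_k(a,c,d)>\pi.$$ (ii) If $a\ge0$, $d^2\ge c^2$ and $c$ has the same sign as $d$, then for all $k\ge1$ $$\sigma\ln\frac{j_{k+1}(a,c,d)}{j_k(a,c,d)}+j_{k+1}(a,c,d)-j_k(a,c,d)>\pi.$$ (iii) If $-1<a<-\frac12$, $d^2\ge c^2$ and $c$ has the opposite sign to $d$, then for all $k\ge1$ $$j_{k+1}(a,c,d)-j_k(a,c,d)-\sigma\ln\frac{\sigma+j_{k+1}(a,c,d)}{\sigma+j_k(a,c,d)}<\pi.$$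
   Context: $J_a$ denotes the Bessel function of the first kind of order $a$. For $a>-1$ and real $c,d$ not both zero, the function $cJ_a(x)+dJ_{a+1}(x)$ has infinitely many positive zeros, which are listed in increasing order as $j_k(a,c,d)$, $k\ge1$. *)

theory Defs
  imports "HOL-Analysis.Analysis"
begin

text \<open>The usual series; because of the real power it is meaningful for \<open>x > 0\<close> only.\<close>
definition Bessel_J :: "real \<Rightarrow> real \<Rightarrow> real" where
  "Bessel_J a x =
     (\<Sum>m. (-1) ^ m / (fact m * Gamma (real m + a + 1)) * (x / 2) powr (2 * real m + a))"

text \<open>\<open>j 1 < j 2 < \<dots>\<close> are exactly the positive zeros of \<open>f\<close>; the value \<open>j 0\<close> is irrelevant.\<close>
definition lists_positive_zeros :: "(nat \<Rightarrow> real) \<Rightarrow> (real \<Rightarrow> real) \<Rightarrow> bool" where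
  "lists_positive_zeros j f \<longleftrightarrow>
     strict_mono_on {1..} j \<and> j ` {1..} = {x. 0 < x \<and> f x = 0}"

end

theory Submission
  imports Defs
begin

text \<open>
  Put \<open>w = c J\<^sub>a + d J\<^sub>a\<^sub>+\<^sub>1\<close> and \<open>z = c J\<^sub>a\<^sub>+\<^sub>1 - d J\<^sub>a\<close>. The recurrences for the derivatives
  of \<open>J\<^sub>a\<close> and \<open>J\<^sub>a\<^sub>+\<^sub>1\<close> become
  \<open>w' = (D - 1/2)/x w - (1 + \<sigma>/x) z\<close> and \<open>z' = (1 - \<sigma>/x) w - (D + 1/2)/x z\<close> with
  \<open>D = (2a + 1)(c\<^sup>2 - d\<^sup>2) / (2(c\<^sup>2 + d\<^sup>2))\<close>, so that \<open>\<sigma>\<^sup>2 + D\<^sup>2 = (a + 1/2)\<^sup>2\<close>.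
  For a new time variable \<open>\<tau>\<close> with \<open>d\<tau>/dx = (x/(x + \<sigma>))\<^sup>n\<^sup>-\<^sup>1\<close>, a positive multiple \<open>V\<close> of \<open>w\<close>
  satisfies an equation \<open>d\<^sup>2V/d\<tau>\<^sup>2 + R V = 0\<close>. The three claims are Sturm comparison with
  \<open>d\<^sup>2y/d\<tau>\<^sup>2 + y = 0\<close>: for \<open>n = 1, 0, 2\<close> the variable is \<open>\<tau> = x\<close>, \<open>x + \<sigma> ln x\<close>, \<open>x - \<sigma> ln (x + \<sigma>)\<close>,
  and \<open>R < 1\<close>, \<open>R < 1\<close>, \<open>R > 1\<close> respectively.
\<close>

section \<open>Derivatives of Bessel functions\<close>

definition bessel_coeff :: "real \<Rightarrow> nat \<Rightarrow> real" where
  "bessel_coeff a m = (-1) ^ m / (fact m * Gamma (real m + a + 1))"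

text \<open>The entire function that remains of \<open>J\<^sub>a(x)\<close> when the factor
  \<open>(x/2)^a\<close> is split off, in the variable \<open>y = x^2/4\<close>. All non-integer
  powers sit in that factor, so termwise differentiation applies to the rest.\<close>

definition bessel_series :: "real \<Rightarrow> real \<Rightarrow> real" where
  "bessel_series a y = (\<Sum>m. bessel_coeff a m * y ^ m)"

lemma bessel_coeff_shift:
  assumes "a > -1"
  shows "(real m + a + 1) * bessel_coeff (a + 1) m = bessel_coeff a m"
proof -
  have pos: "real m + a + 1 > 0" using assms by linarith
  have "Gamma (real m + (a + 1) + 1) = (real m + a + 1) * Gamma (real m + a + 1)"
    using Gamma_plus1[of "real m + a + 1"] pos
    by (metis add.assoc nonpos_Ints_nonpos not_le)
  then show ?thesis
    using pos by (simp add: bessel_coeff_def)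
qed

text \<open>Raising the index and raising the order shift the argument of Gamma equally, so only the
  sign and the factorial change.\<close>

lemma bessel_coeff_Suc: "real (Suc m) * bessel_coeff a (Suc m) = - bessel_coeff (a + 1) m"
proof -
  have "real (Suc m) + a + 1 = real m + (a + 1) + 1" by simp
  then show ?thesis
    unfolding bessel_coeff_def fact_Suc by (simp only:) (simp add: divide_simps del: of_nat_Suc)
qed

lemma summable_bessel_series:
  assumes "a > -1"
  shows "summable (\<lambda>m. bessel_coeff a m * y ^ m)"
proof (rule summable_ratio_test)
  show "(1/2::real) < 1" by simp
next
  fix m :: nat
  \<comment> \<open>Consecutive coefficients have ratio \<open>-1/((m+1)(m+a+1))\<close>. The
    ceiling gives \<open>m + 1 \<ge> 2 * \<bar>y\<bar>\<close> and the extra 1 gives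
    \<open>m + a + 1 \<ge> 1\<close>, which makes the ratio of terms at most 1/2.\<close>
  assume m: "m \<ge> nat \<lceil>2 * \<bar>y\<bar>\<rceil> + 1"
  have my: "real (Suc m) \<ge> 2 * \<bar>y\<bar>" using m by linarith
  have m1: "real m + a + 1 \<ge> 1" using m assms by linarith
  have "real (Suc m) * (real m + a + 1) * bessel_coeff a (Suc m) = - bessel_coeff a m"
  proof -
    have "real (Suc m) * (real m + a + 1) * bessel_coeff a (Suc m) =
        (real m + a + 1) * (real (Suc m) * bessel_coeff a (Suc m))"
      by (simp only: mult_ac)
    then show ?thesis
      unfolding bessel_coeff_Suc using bessel_coeff_shift[OF assms, of m] by simp
  qed
  from arg_cong[OF this, of abs]
  have eq: "real (Suc m) * (real m + a + 1) * \<bar>bessel_coeff a (Suc m)\<bar> = \<bar>bessel_coeff a m\<bar>"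
    using m1 by (simp add: abs_mult del: of_nat_Suc)
  have "2 * \<bar>y\<bar> * \<bar>bessel_coeff a (Suc m)\<bar> \<le> real (Suc m) * (real m + a + 1) * \<bar>bessel_coeff a (Suc m)\<bar>"
    using mult_mono[OF my m1] by (intro mult_right_mono) auto
  then have "\<bar>y\<bar> * \<bar>bessel_coeff a (Suc m)\<bar> \<le> 1/2 * \<bar>bessel_coeff a m\<bar>"
    using eq by simp
  then have "\<bar>y\<bar> * \<bar>bessel_coeff a (Suc m)\<bar> * \<bar>y\<bar> ^ m \<le> 1/2 * \<bar>bessel_coeff a m\<bar> * \<bar>y\<bar> ^ m"
    by (intro mult_right_mono) auto
  then show "norm (bessel_coeff a (Suc m) * y ^ Suc m) \<le> 1/2 * norm (bessel_coeff a m * y ^ m)"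
    by (simp add: abs_mult power_abs mult_ac)
qed

lemma has_real_derivative_bessel_series:
  assumes "a > -1"
  shows "(bessel_series a has_real_derivative - bessel_series (a + 1) y) (at y)"
proof -
  have "((\<lambda>y. \<Sum>m. bessel_coeff a m * y ^ m) has_real_derivative
          (\<Sum>m. diffs (bessel_coeff a) m * y ^ m)) (at y)"
    by (rule termdiffs_strong_converges_everywhere) (rule summable_bessel_series[OF assms])
  moreover have "(\<Sum>m. diffs (bessel_coeff a) m * y ^ m) = - bessel_series (a + 1) y"
    using summable_bessel_series[of "a + 1" y] assms
    by (simp add: diffs_def bessel_coeff_Suc bessel_series_def suminf_minus del: of_nat_Suc)
  ultimately show ?thesis
    by (simp add: bessel_series_def[abs_def])
qed

text \<open>This is \<open>J\<^sub>a + J\<^sub>a\<^sub>+\<^sub>2 = (2(a+1)/x)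
  J\<^sub>a\<^sub>+\<^sub>1\<close> with the powers of \<open>x/2\<close> removed. By
  \<open>bessel_coeff_shift\<close> the coefficients on the left are
  \<open>(m + a + 1) * ?b m\<close>; the part with factor \<open>m\<close> is y times the derivative
  of the middle series.\<close>

lemma bessel_series_recurrence:
  assumes "a > -1"
  shows "bessel_series a y = (a + 1) * bessel_series (a + 1) y - y * bessel_series (a + 2) y"
proof -
  let ?b = "bessel_coeff (a + 1)"
  have sum0: "summable (\<lambda>m. ?b m * y ^ m)"
    using assms by (intro summable_bessel_series) auto
  have sum2: "summable (\<lambda>m. bessel_coeff (a + 2) m * y ^ m)"
    using assms by (intro summable_bessel_series) auto
  have Suc_term: "real (Suc m) * ?b (Suc m) * y ^ Suc m = - y * (bessel_coeff (a + 2) m * y ^ m)" for m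
    using bessel_coeff_Suc[of m "a + 1"] by (simp add: add.assoc mult_ac del: of_nat_Suc)
  have "(\<lambda>m. - y * (bessel_coeff (a + 2) m * y ^ m)) sums (- y * bessel_series (a + 2) y)"
    using sum2 unfolding bessel_series_def by (intro sums_mult summable_sums)
  then have "(\<lambda>m. real (Suc m) * ?b (Suc m) * y ^ Suc m) sums (- y * bessel_series (a + 2) y)"
    unfolding Suc_term .
  \<comment> \<open>The factor \<open>real m\<close> kills the term at 0, so undoing the index shift
    does not change the sum.\<close>
  then have "(\<lambda>m. real m * ?b m * y ^ m) sums (- y * bessel_series (a + 2) y)"
    by (subst (asm) sums_Suc_iff) simp
  moreover have "(\<lambda>m. (a + 1) * (?b m * y ^ m)) sums ((a + 1) * bessel_series (a + 1) y)"
    using sum0 unfolding bessel_series_def by (intro sums_mult summable_sums)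
  ultimately have "(\<lambda>m. real m * ?b m * y ^ m + (a + 1) * (?b m * y ^ m)) sums
      (- y * bessel_series (a + 2) y + (a + 1) * bessel_series (a + 1) y)"
    by (rule sums_add)
  moreover have "real m * ?b m * y ^ m + (a + 1) * (?b m * y ^ m) = bessel_coeff a m * y ^ m" for m
    using bessel_coeff_shift[OF assms, of m, symmetric] by (simp add: algebra_simps)
  ultimately show ?thesis
    unfolding bessel_series_def by (simp add: sums_iff)
qed

section \<open>First-order system for \<open>J\<^sub>a\<close> and
  \<open>J\<^sub>a\<^sub>+\<^sub>1\<close>\<close>

lemma Bessel_J_eq_bessel_series:
  assumes "a > -1" "x > 0"
  shows "Bessel_J a x = (x/2) powr a * bessel_series a (x\<^sup>2 / 4)"
proof -
  have "(x/2) powr (2 * real m + a) = (x/2) powr a * (x\<^sup>2/4) ^ m" for m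
  proof -
    have "(x/2) powr (2 * real m) = (x/2) ^ (2 * m)"
      using assms powr_realpow[of "x/2" "2 * m"] by simp
    then show ?thesis
      by (simp add: powr_add power_mult power_divide)
  qed
  then have "Bessel_J a x = (\<Sum>m. (x/2) powr a * (bessel_coeff a m * (x\<^sup>2/4) ^ m))"
    unfolding Bessel_J_def bessel_coeff_def by (simp add: mult_ac)
  also have "\<dots> = (x/2) powr a * bessel_series a (x\<^sup>2 / 4)"
    unfolding bessel_series_def by (rule suminf_mult[OF summable_bessel_series[OF assms(1)]])
  finally show ?thesis .
qed

lemma has_real_derivative_Bessel_J:
  assumes "a > -1" "x > 0"
  shows "(Bessel_J a has_real_derivative a / x * Bessel_J a x - Bessel_J (a + 1) x) (at x)"
proof -
  have "((\<lambda>x. (x/2) powr a * bessel_series a (x\<^sup>2 / 4)) has_real_derivative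
          a / x * Bessel_J a x - Bessel_J (a + 1) x) (at x)"
    using assms
    by (auto intro!: derivative_eq_intros DERIV_chain'[OF _ has_real_derivative_bessel_series]
        simp: Bessel_J_eq_bessel_series powr_add powr_diff field_simps)
  \<comment> \<open>The factorisation is available for positive arguments only, so the derivative is
    transferred on the open half-line.\<close>
  then show ?thesis
    by (rule has_field_derivative_transform_within_open[where S = "{0<..}"])
      (use assms in \<open>auto simp: Bessel_J_eq_bessel_series\<close>)
qed

text \<open>The previous lemma at order \<open>a + 1\<close> produces
  \<open>J\<^sub>a\<^sub>+\<^sub>2\<close>. Eliminating it by the recurrence closes the pair
  \<open>J\<^sub>a\<close>, \<open>J\<^sub>a\<^sub>+\<^sub>1\<close> under differentiation.\<close>

lemma has_real_derivative_Bessel_J':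
  assumes "a > -1" "x > 0"
  shows "(Bessel_J (a + 1) has_real_derivative
           Bessel_J a x - (a + 1) / x * Bessel_J (a + 1) x) (at x)"
proof -
  have "Bessel_J a x = (x/2) powr a *
      ((a + 1) * bessel_series (a + 1) (x\<^sup>2/4) - x\<^sup>2/4 * bessel_series (a + 2) (x\<^sup>2/4))"
    using assms bessel_series_recurrence[of a "x\<^sup>2/4"] by (simp add: Bessel_J_eq_bessel_series)
  moreover have "Bessel_J (a + 2) x = (x/2) powr a * (x\<^sup>2/4 * bessel_series (a + 2) (x\<^sup>2/4))"
    using assms by (simp add: Bessel_J_eq_bessel_series powr_add power_divide)
  moreover have "2 * ((a + 1) / x * Bessel_J (a + 1) x) =
      (x/2) powr a * ((a + 1) * bessel_series (a + 1) (x\<^sup>2/4))"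
    using assms by (simp add: Bessel_J_eq_bessel_series powr_add)
  ultimately have eq: "(a + 1) / x * Bessel_J (a + 1) x - Bessel_J (a + 2) x =
      Bessel_J a x - (a + 1) / x * Bessel_J (a + 1) x"
    by (simp only: right_diff_distrib)
  have "(Bessel_J (a + 1) has_real_derivative
      (a + 1) / x * Bessel_J (a + 1) x - Bessel_J (a + 2) x) (at x)"
    using has_real_derivative_Bessel_J[of "a + 1" x] assms by (simp add: add.assoc)
  then show ?thesis unfolding eq .
qed

section \<open>Sturm comparison\<close>

text \<open>In the variable \<tau> the system is \<open>dV/d\<tau> = U\<close>,
  \<open>dU/d\<tau> = -(G/\<tau>') V\<close>, so \<open>G x < \<tau>' x\<close> says R < 1. If the
  gap were at most pi, the Wronskian \<open>F\<close> of \<open>V\<close> with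
  \<open>sin (\<tau> x - \<tau> x1)\<close> would increase strictly from 0, yet its value at
  \<open>x2\<close> is not positive.\<close>

lemma sturm_gap_greater_pos:
  fixes V U \<tau> \<tau>' G :: "real \<Rightarrow> real"
  assumes "x1 < x2"
    and V: "\<And>x. x \<in> {x1..x2} \<Longrightarrow> (V has_real_derivative \<tau>' x * U x) (at x)"
    and U: "\<And>x. x \<in> {x1..x2} \<Longrightarrow> (U has_real_derivative - G x * V x) (at x)"
    and \<tau>: "\<And>x. x \<in> {x1..x2} \<Longrightarrow> (\<tau> has_real_derivative \<tau>' x) (at x)"
    and \<tau>'_pos: "\<And>x. x \<in> {x1..x2} \<Longrightarrow> \<tau>' x > 0"
    and less: "\<And>x. x \<in> {x1<..<x2} \<Longrightarrow> G x < \<tau>' x"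
    and zeros: "V x1 = 0" "V x2 = 0"
    and pos: "\<And>x. x \<in> {x1<..<x2} \<Longrightarrow> V x > 0"
  shows "\<tau> x2 - \<tau> x1 > pi"
proof (rule ccontr)
  assume neg: "\<not> \<tau> x2 - \<tau> x1 > pi"
  define F where "F x = U x * sin (\<tau> x - \<tau> x1) - V x * cos (\<tau> x - \<tau> x1)" for x
  have mono: "\<tau> x < \<tau> y" if "x1 \<le> x" "x < y" "y \<le> x2" for x y
  proof (rule DERIV_pos_imp_increasing[OF \<open>x < y\<close>])
    fix t assume "x \<le> t" "t \<le> y"
    then have "t \<in> {x1..x2}" using that by simp
    then show "\<exists>y. (\<tau> has_real_derivative y) (at t) \<and> y > 0" using \<tau> \<tau>'_pos by blast
  qed
  have F: "(F has_real_derivative (\<tau>' x - G x) * V x * sin (\<tau> x - \<tau> x1)) (at x)"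
    if "x \<in> {x1..x2}" for x
    unfolding F_def
    by (rule derivative_eq_intros V U \<tau> that refl)+ (simp add: algebra_simps)
  have "F x1 < F x2"
  proof (rule DERIV_pos_imp_increasing_open[OF \<open>x1 < x2\<close>])
    fix x assume x: "x1 < x" "x < x2"
    have "\<tau> x - \<tau> x1 > 0" "\<tau> x - \<tau> x1 < pi"
      using mono[of x1 x] mono[of x x2] x neg by auto
    then have "(\<tau>' x - G x) * V x * sin (\<tau> x - \<tau> x1) > 0"
      using less[of x] pos[of x] x by (simp add: sin_gt_zero)
    then show "\<exists>y. (F has_real_derivative y) (at x) \<and> y > 0"
      using F[of x] x by auto
  next
    show "continuous_on {x1..x2} F"
      using F by (meson DERIV_isCont continuous_at_imp_continuous_on)
  qed
  moreover have "F x1 = 0" by (simp add: F_def zeros)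
  \<comment> \<open>\<open>V\<close> is positive just left of its zero \<open>x2\<close>, so its
    slope \<open>\<tau>' x2 * U x2\<close> there cannot be positive.\<close>
  moreover have "U x2 \<le> 0"
  proof (rule ccontr)
    assume "\<not> U x2 \<le> 0"
    then have "\<tau>' x2 * U x2 > 0" using \<tau>'_pos[of x2] \<open>x1 < x2\<close> by simp
    from DERIV_pos_inc_left[OF V[of x2] this] obtain e
      where e: "e > 0" "\<And>h. h > 0 \<Longrightarrow> h < e \<Longrightarrow> V (x2 - h) < V x2"
      using \<open>x1 < x2\<close> by auto
    define h where "h = min e (x2 - x1) / 2"
    have "0 < h" "h < e" "h < x2 - x1" using e(1) \<open>x1 < x2\<close> by (auto simp: h_def min_def)
    then show False using e(2)[of h] pos[of "x2 - h"] zeros by auto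
  qed
  moreover have "sin (\<tau> x2 - \<tau> x1) \<ge> 0"
    using neg mono[of x1 x2] \<open>x1 < x2\<close> by (intro sin_ge_zero) auto
  ultimately show False
    using mult_nonpos_nonneg[of "U x2" "sin (\<tau> x2 - \<tau> x1)"] by (simp add: F_def zeros)
qed

text \<open>With R > 1 the same Wronskian decreases strictly from 0 while the sine is positive. At
  the point where \<tau> has advanced by pi it equals \<open>V\<close>, which is not negative there
  if the gap is at least pi.\<close>

lemma sturm_gap_less_pos:
  fixes V U \<tau> \<tau>' G :: "real \<Rightarrow> real"
  assumes "x1 < x2"
    and V: "\<And>x. x \<in> {x1..x2} \<Longrightarrow> (V has_real_derivative \<tau>' x * U x) (at x)"
    and U: "\<And>x. x \<in> {x1..x2} \<Longrightarrow> (U has_real_derivative - G x * V x) (at x)"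
    and \<tau>: "\<And>x. x \<in> {x1..x2} \<Longrightarrow> (\<tau> has_real_derivative \<tau>' x) (at x)"
    and \<tau>'_pos: "\<And>x. x \<in> {x1..x2} \<Longrightarrow> \<tau>' x > 0"
    and greater: "\<And>x. x \<in> {x1<..<x2} \<Longrightarrow> G x > \<tau>' x"
    and zeros: "V x1 = 0" "V x2 = 0"
    and pos: "\<And>x. x \<in> {x1<..<x2} \<Longrightarrow> V x > 0"
  shows "\<tau> x2 - \<tau> x1 < pi"
proof (rule ccontr)
  assume neg: "\<not> \<tau> x2 - \<tau> x1 < pi"
  define F where "F x = U x * sin (\<tau> x - \<tau> x1) - V x * cos (\<tau> x - \<tau> x1)" for x
  have mono: "\<tau> x < \<tau> y" if "x1 \<le> x" "x < y" "y \<le> x2" for x y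
  proof (rule DERIV_pos_imp_increasing[OF \<open>x < y\<close>])
    fix t assume "x \<le> t" "t \<le> y"
    then have "t \<in> {x1..x2}" using that by simp
    then show "\<exists>y. (\<tau> has_real_derivative y) (at t) \<and> y > 0" using \<tau> \<tau>'_pos by blast
  qed
  have "continuous_on {x1..x2} \<tau>"
    using \<tau> by (meson DERIV_isCont continuous_at_imp_continuous_on)
  \<comment> \<open>Beyond \<open>x3\<close> the sine may turn negative, so the comparison stops
    there. The case \<open>x3 = x2\<close> is possible and harmless, since
    \<open>V x2 = 0\<close>.\<close>
  then obtain x3 where x3: "x1 \<le> x3" "x3 \<le> x2" "\<tau> x3 = \<tau> x1 + pi"
    using IVT'[of \<tau> x1 "\<tau> x1 + pi" x2] neg \<open>x1 < x2\<close> by auto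
  have "x1 \<noteq> x3" using x3(3) pi_gt_zero by auto
  then have "x1 < x3" using x3(1) by simp
  have F: "(F has_real_derivative (\<tau>' x - G x) * V x * sin (\<tau> x - \<tau> x1)) (at x)"
    if "x \<in> {x1..x2}" for x
    unfolding F_def
    by (rule derivative_eq_intros V U \<tau> that refl)+ (simp add: algebra_simps)
  have "F x1 > F x3"
  proof (rule DERIV_neg_imp_decreasing_open[OF \<open>x1 < x3\<close>])
    fix x assume x: "x1 < x" "x < x3"
    have "\<tau> x - \<tau> x1 > 0" "\<tau> x - \<tau> x1 < pi"
      using mono[of x1 x] mono[of x x3] x x3 by auto
    then have "(G x - \<tau>' x) * V x * sin (\<tau> x - \<tau> x1) > 0"
      using greater[of x] pos[of x] x x3 by (simp add: sin_gt_zero)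
    then have "(\<tau>' x - G x) * V x * sin (\<tau> x - \<tau> x1) < 0"
      by (simp add: algebra_simps)
    then show "\<exists>y. (F has_real_derivative y) (at x) \<and> y < 0"
      using F[of x] x x3 by auto
  next
    show "continuous_on {x1..x3} F"
      using F x3 by (meson DERIV_isCont continuous_at_imp_continuous_on atLeastAtMost_iff order_trans)
  qed
  moreover have "F x1 = 0" by (simp add: F_def zeros)
  moreover have "F x3 = V x3" by (simp add: F_def x3)
  moreover have "V x3 \<ge> 0"
    using pos[of x3] zeros x3 \<open>x1 < x3\<close> by (cases "x3 = x2") auto
  ultimately show False by simp
qed

lemma nonzero_imp_constant_sign:
  fixes V :: "real \<Rightarrow> real"
  assumes "continuous_on {x1<..<x2} V" "\<And>x. x \<in> {x1<..<x2} \<Longrightarrow> V x \<noteq> 0"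
  shows "(\<forall>x\<in>{x1<..<x2}. V x > 0) \<or> (\<forall>x\<in>{x1<..<x2}. V x < 0)"
proof (rule ccontr)
  assume "\<not> ?thesis"
  then obtain x y where xy: "x \<in> {x1<..<x2}" "y \<in> {x1<..<x2}" "V x \<le> 0" "V y \<ge> 0"
    by (meson not_le)
  have "connected (V ` {x1<..<x2})"
    using assms(1) by (intro connected_continuous_image) auto
  then have "0 \<in> V ` {x1<..<x2}"
    using xy by (meson connectedD_interval imageI)
  then show False using assms(2) by auto
qed

text \<open>By continuity \<open>V\<close> has one sign between the two zeros, and the system is
  invariant under replacing \<open>(V, U)\<close> by \<open>(-V, -U)\<close>; hence the positive
  case suffices.\<close>

lemma sturm_gap:
  fixes V U \<tau> \<tau>' G :: "real \<Rightarrow> real"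
  assumes "x1 < x2"
    and V: "\<And>x. x \<in> {x1..x2} \<Longrightarrow> (V has_real_derivative \<tau>' x * U x) (at x)"
    and U: "\<And>x. x \<in> {x1..x2} \<Longrightarrow> (U has_real_derivative - G x * V x) (at x)"
    and \<tau>: "\<And>x. x \<in> {x1..x2} \<Longrightarrow> (\<tau> has_real_derivative \<tau>' x) (at x)"
    and \<tau>'_pos: "\<And>x. x \<in> {x1..x2} \<Longrightarrow> \<tau>' x > 0"
    and zeros: "V x1 = 0" "V x2 = 0"
    and nz: "\<And>x. x \<in> {x1<..<x2} \<Longrightarrow> V x \<noteq> 0"
  shows sturm_gap_greater: "(\<And>x. x \<in> {x1<..<x2} \<Longrightarrow> G x < \<tau>' x) \<Longrightarrow> \<tau> x2 - \<tau> x1 > pi"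
    and sturm_gap_less: "(\<And>x. x \<in> {x1<..<x2} \<Longrightarrow> G x > \<tau>' x) \<Longrightarrow> \<tau> x2 - \<tau> x1 < pi"
proof -
  have "continuous_on {x1<..<x2} V"
    using V by (meson DERIV_isCont continuous_at_imp_continuous_on
        greaterThanLessThan_subseteq_atLeastAtMost_iff order_refl subsetD)
  from nonzero_imp_constant_sign[OF this nz]
  consider "\<And>x. x \<in> {x1<..<x2} \<Longrightarrow> V x > 0" | "\<And>x. x \<in> {x1<..<x2} \<Longrightarrow> - V x > 0"
    by fastforce
  then obtain V2 U2 where
      V2: "\<And>x. x \<in> {x1..x2} \<Longrightarrow> (V2 has_real_derivative \<tau>' x * U2 x) (at x)"
    and U2: "\<And>x. x \<in> {x1..x2} \<Longrightarrow> (U2 has_real_derivative - G x * V2 x) (at x)"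
    and zeros2: "V2 x1 = 0" "V2 x2 = 0"
    and pos2: "\<And>x. x \<in> {x1<..<x2} \<Longrightarrow> V2 x > 0"
  proof cases
    case 1
    then show ?thesis using that[of V U] V U zeros by blast
  next
    case 2
    show ?thesis
    proof (rule that[of "\<lambda>x. - V x" "\<lambda>x. - U x"])
      show "((\<lambda>x. - V x) has_real_derivative \<tau>' x * - U x) (at x)" if "x \<in> {x1..x2}" for x
        using DERIV_minus[OF V[OF that]] by simp
      show "((\<lambda>x. - U x) has_real_derivative - G x * - V x) (at x)" if "x \<in> {x1..x2}" for x
        using DERIV_minus[OF U[OF that]] by simp
    qed (use zeros 2 in auto)
  qed
  show "\<tau> x2 - \<tau> x1 > pi" if "\<And>x. x \<in> {x1<..<x2} \<Longrightarrow> G x < \<tau>' x"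
    by (rule sturm_gap_greater_pos[OF \<open>x1 < x2\<close> V2 U2 \<tau> \<tau>'_pos that zeros2 pos2])
  show "\<tau> x2 - \<tau> x1 < pi" if "\<And>x. x \<in> {x1<..<x2} \<Longrightarrow> G x > \<tau>' x"
    by (rule sturm_gap_less_pos[OF \<open>x1 < x2\<close> V2 U2 \<tau> \<tau>'_pos that zeros2 pos2])
qed

section \<open>Reduction of the rotated Bessel system to Sturm form\<close>

text \<open>\<open>T\<close> is what \<open>G\<close> becomes after clearing denominators, so the
  comparison of R with 1 turns into an explicit inequality in x. The time change is written with
  exponent \<open>n\<close> and the factor \<open>1 + \<sigma> / x\<close> instead of exponent
  \<open>n - 1\<close>, so that \<open>n = 0\<close> is covered by natural powers.\<close>

lemma rotated_Bessel_system_gap: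
  fixes w z \<tau> :: "real \<Rightarrow> real" and \<sigma> D :: real and n :: nat
  defines "T \<equiv> \<lambda>x. (x - \<sigma>) * (x + \<sigma>) ^ 3 + D * x * (x + \<sigma>) + n * \<sigma> * x
            - D\<^sup>2 * (x + \<sigma>)\<^sup>2 + n\<^sup>2 * \<sigma>\<^sup>2 / 4"
  assumes "\<sigma> \<ge> 0" "0 < x1" "x1 < x2"
    and w: "\<And>x. x > 0 \<Longrightarrow>
      (w has_real_derivative (D - 1/2) / x * w x - (1 + \<sigma> / x) * z x) (at x)"
    and z: "\<And>x. x > 0 \<Longrightarrow>
      (z has_real_derivative (1 - \<sigma> / x) * w x - (D + 1/2) / x * z x) (at x)"
    and zeros: "w x1 = 0" "w x2 = 0"
    and nz: "\<And>x. x \<in> {x1<..<x2} \<Longrightarrow> w x \<noteq> 0"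
    and \<tau>: "\<And>x. x > 0 \<Longrightarrow> 
      (\<tau> has_real_derivative (x / (x + \<sigma>)) ^ n * (1 + \<sigma> / x)) (at x)"
  shows rotated_Bessel_system_gap_greater:
      "(\<And>x. x > 0 \<Longrightarrow> T x < (x / (x + \<sigma>)) ^ (2 * n) * (x + \<sigma>) ^ 4) \<Longrightarrow> \<tau> x2 - \<tau> x1 > pi"
    and rotated_Bessel_system_gap_less:
      "(\<And>x. x > 0 \<Longrightarrow> T x > (x / (x + \<sigma>)) ^ (2 * n) * (x + \<sigma>) ^ 4) \<Longrightarrow> \<tau> x2 - \<tau> x1 < pi"
proof -
  \<comment> \<open>These are \<open>\<rho>^2 = x P\<close> and \<open>\<eta>^2 = x / P\<close> with
    \<open>P = (x/(x+\<sigma>))^n\<close>. The relation \<open>\<rho> = P \<eta>\<close> matches the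
    z-terms in \<open>V' = \<tau>' U\<close>, and \<open>\<rho> \<eta> = x\<close> makes z drop out
    of \<open>U'\<close>. Exponentials of logarithms give positivity and the logarithmic derivatives
    at once.\<close>
  define \<rho> where "\<rho> x = exp ((1 + real n) / 2 * ln x - real n / 2 * ln (x + \<sigma>))" for x
  define \<eta> where "\<eta> x = exp ((1 - real n) / 2 * ln x + real n / 2 * ln (x + \<sigma>))" for x
  \<comment> \<open>Chosen so that the coefficient of \<open>w\<close> in \<open>V' / \<rho>\<close>
    is \<open>(1 + \<sigma> / x) * \<kappa> x\<close>.\<close>
  define \<kappa> where "\<kappa> x = D / (x + \<sigma>) + n * \<sigma> / (2 * (x + \<sigma>)\<^sup>2)" for x
  define \<tau>' where "\<tau>' x = (x / (x + \<sigma>)) ^ n * (1 + \<sigma> / x)" for x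
  \<comment> \<open>\<open>- E\<close> is the coefficient of \<open>w\<close> left in
    \<open>U' / \<eta>\<close>; division by \<open>P\<close> then converts \<open>\<eta> w\<close>
    into \<open>V\<close>.\<close>
  define E where "E x = (x - \<sigma>) / x + D / (x + \<sigma>)\<^sup>2 + n * \<sigma> / (x + \<sigma>) ^ 3
            - (D\<^sup>2 - n\<^sup>2 * \<sigma>\<^sup>2 / (4 * (x + \<sigma>)\<^sup>2)) / (x * (x + \<sigma>))" for x
  define P where "P x = (x / (x + \<sigma>)) ^ n" for x
  define V where "V x = \<rho> x * w x" for x
  define U where "U x = \<eta> x * (\<kappa> x * w x - z x)" for x
  define G where "G x = E x / P x" for x
  have P_pos: "P x > 0" if "x > 0" for x
    using that \<open>\<sigma> \<ge> 0\<close> by (simp add: P_def)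
  have \<rho>_eq: "\<rho> x = P x * \<eta> x" if "x > 0" for x
  proof -
    have "P x = exp (n * (ln x - ln (x + \<sigma>)))"
      using that \<open>\<sigma> \<ge> 0\<close> by (simp add: P_def exp_of_nat_mult exp_diff)
    then show ?thesis
      by (simp add: \<rho>_def \<eta>_def flip: exp_add) (simp add: field_simps)
  qed
  have \<rho>: "(\<rho> has_real_derivative \<rho> x * ((1 + real n) / (2 * x) - n / (2 * (x + \<sigma>)))) (at x)"
    and \<eta>: "(\<eta> has_real_derivative \<eta> x * ((1 - real n) / (2 * x) + n / (2 * (x + \<sigma>)))) (at x)"
    and \<kappa>: "(\<kappa> has_real_derivative - D / (x + \<sigma>)\<^sup>2 - n * \<sigma> / (x + \<sigma>) ^ 3) (at x)"
    if "x > 0" for x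
  proof -
    have ne: "x > 0" "x + \<sigma> > 0" "x + \<sigma> \<noteq> 0" using that \<open>\<sigma> \<ge> 0\<close> by auto
    have *: "((\<lambda>x. exp (p * ln x + q * ln (x + \<sigma>))) has_real_derivative
        exp (p * ln x + q * ln (x + \<sigma>)) * (p / x + q / (x + \<sigma>))) (at x)" for p q
      using ne by (auto intro!: derivative_eq_intros)
    show "(\<rho> has_real_derivative \<rho> x * ((1 + real n) / (2 * x) - n / (2 * (x + \<sigma>)))) (at x)"
      unfolding \<rho>_def using *[of "(1 + real n) / 2" "- (real n / 2)"] by simp
    show "(\<eta> has_real_derivative \<eta> x * ((1 - real n) / (2 * x) + n / (2 * (x + \<sigma>)))) (at x)"
      unfolding \<eta>_def using *[of "(1 - real n) / 2" "real n / 2"] by simp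
    have "((\<lambda>x. D * inverse (x + \<sigma>) + n * \<sigma> / 2 * (inverse (x + \<sigma>))\<^sup>2) has_real_derivative
        - D * (inverse (x + \<sigma>))\<^sup>2 - n * \<sigma> * inverse (x + \<sigma>) ^ 3) (at x)"
      using ne by (auto intro!: derivative_eq_intros simp: power_numeral_reduce)
    then show "(\<kappa> has_real_derivative - D / (x + \<sigma>)\<^sup>2 - n * \<sigma> / (x + \<sigma>) ^ 3) (at x)"
      unfolding \<kappa>_def by (simp add: inverse_eq_divide power_divide)
  qed
  have V: "(V has_real_derivative \<tau>' x * U x) (at x)" if "x > 0" for x
  proof -
    have ne: "x \<noteq> 0" "x + \<sigma> \<noteq> 0" using that \<open>\<sigma> \<ge> 0\<close> by auto
    have coeff: "(1 + real n) / (2 * x) - n / (2 * (x + \<sigma>)) + (D - 1/2) / x = (1 + \<sigma> / x) * \<kappa> x"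
      using ne unfolding \<kappa>_def by (simp add: divide_simps) (simp add: algebra_simps power2_eq_square)
    have "(V has_real_derivative
        \<rho> x * (((1 + real n) / (2 * x) - n / (2 * (x + \<sigma>)) + (D - 1/2) / x) * w x - (1 + \<sigma> / x) * z x)) (at x)"
      unfolding V_def
      by (rule derivative_eq_intros \<rho> w that refl)+ (simp add: algebra_simps)
    then show ?thesis
      unfolding coeff using that
      by (simp add: \<tau>'_def U_def \<rho>_eq P_def algebra_simps)
  qed
  have U: "(U has_real_derivative - G x * V x) (at x)" if "x > 0" for x
  proof -
    have ne: "x \<noteq> 0" "x + \<sigma> \<noteq> 0" using that \<open>\<sigma> \<ge> 0\<close> by auto
    define l where "l = (1 - real n) / (2 * x) + n / (2 * (x + \<sigma>))"
    have \<eta>_l: "(\<eta> has_real_derivative \<eta> x * l) (at x)"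
      using \<eta>[OF that] by (simp only: l_def)
    have z_coeff: "l + (1 + \<sigma> / x) * \<kappa> x - (D + 1/2) / x = 0"
      using ne unfolding l_def \<kappa>_def by (simp add: divide_simps) (simp add: algebra_simps power2_eq_square)
    have w_coeff: "l * \<kappa> x + (- D / (x + \<sigma>)\<^sup>2 - n * \<sigma> / (x + \<sigma>) ^ 3) + \<kappa> x * ((D - 1/2) / x)
        - (1 - \<sigma> / x) = - E x"
    proof -
      \<comment> \<open>The two factors are conjugate, \<open>D\<close> minus and plus the same
        term, so their product is a difference of squares.\<close>
      have 1: "l + (D - 1/2) / x = (D - n * \<sigma> / (2 * (x + \<sigma>))) / x"
        using ne unfolding l_def by (simp add: divide_simps) (simp add: algebra_simps)
      have 2: "\<kappa> x = (D + n * \<sigma> / (2 * (x + \<sigma>))) / (x + \<sigma>)"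
        unfolding \<kappa>_def by (simp add: add_divide_distrib power2_eq_square)
      have "(l + (D - 1/2) / x) * \<kappa> x = (D\<^sup>2 - n\<^sup>2 * \<sigma>\<^sup>2 / (4 * (x + \<sigma>)\<^sup>2)) / (x * (x + \<sigma>))"
        unfolding 1 2 times_divide_times_eq
        by (rule arg_cong2[where f = "(/)"])
          (simp_all add: algebra_simps power2_eq_square)
      then show ?thesis
        using ne unfolding E_def by (simp add: algebra_simps diff_divide_distrib)
    qed
    have "(U has_real_derivative \<eta> x *
        ((l * \<kappa> x + (- D / (x + \<sigma>)\<^sup>2 - n * \<sigma> / (x + \<sigma>) ^ 3) + \<kappa> x * ((D - 1/2) / x) - (1 - \<sigma> / x)) * w x
         - (l + (1 + \<sigma> / x) * \<kappa> x - (D + 1/2) / x) * z x)) (at x)"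
      unfolding U_def
      by (rule derivative_eq_intros \<eta>_l \<kappa> w z that refl)+ (simp add: algebra_simps)
    then show ?thesis
      unfolding z_coeff w_coeff using that P_pos[OF that]
      by (simp add: G_def V_def \<rho>_eq mult.left_commute)
  qed
  have \<tau>'_pos: "\<tau>' x > 0" if "x > 0" for x
    using P_pos[OF that] that \<open>\<sigma> \<ge> 0\<close> unfolding \<tau>'_def P_def by (intro mult_pos_pos) (auto intro: add_pos_nonneg)
  have V_zeros: "V x1 = 0" "V x2 = 0" by (simp_all add: V_def zeros)
  have V_nz: "V x \<noteq> 0" if "x \<in> {x1<..<x2}" for x
    using nz[OF that] by (simp add: V_def \<rho>_def)
  have \<tau>': "(\<tau> has_real_derivative \<tau>' x) (at x)" if "x > 0" for x
    using \<tau>[OF that] by (simp add: \<tau>'_def)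
  \<comment> \<open>A positive multiplier that clears the denominators of \<open>G\<close> and
    \<open>\<tau>'\<close> together.\<close>
  define M where "M x = P x * x * (x + \<sigma>) ^ 3" for x
  have M_pos: "M x > 0" if "x > 0" for x
    using P_pos[OF that] that \<open>\<sigma> \<ge> 0\<close> by (simp add: M_def)
  have G_M: "G x * M x = T x" if "x > 0" for x
  proof -
    have ne: "x \<noteq> 0" "x + \<sigma> \<noteq> 0" using that \<open>\<sigma> \<ge> 0\<close> by auto
    have "G x * M x = E x * (x * (x + \<sigma>) ^ 3)"
      using P_pos[OF that] by (simp add: G_def M_def)
    also have "\<dots> = T x"
      using ne unfolding E_def T_def by (simp add: divide_simps) (simp add: algebra_simps power_numeral_reduce)
    finally show ?thesis .
  qed
  have \<tau>'_M: "\<tau>' x * M x = (x / (x + \<sigma>)) ^ (2 * n) * (x + \<sigma>) ^ 4" if "x > 0" for x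
  proof -
    have "(1 + \<sigma> / x) * x = x + \<sigma>" using that by (simp add: field_simps)
    moreover have "\<tau>' x * M x = (P x)\<^sup>2 * ((1 + \<sigma> / x) * x) * (x + \<sigma>) ^ 3"
      by (simp add: \<tau>'_def M_def P_def power2_eq_square)
    ultimately show ?thesis
      by (simp add: P_def power_numeral_reduce power_mult_distrib flip: power_mult power_add mult_2)
  qed
  have x_pos: "x > 0" if "x \<in> {x1..x2}" for x using that \<open>0 < x1\<close> by auto
  show "\<tau> x2 - \<tau> x1 > pi" if T: "\<And>x. x > 0 \<Longrightarrow> T x < (x / (x + \<sigma>)) ^ (2 * n) * (x + \<sigma>) ^ 4"
  proof (rule sturm_gap_greater[OF \<open>x1 < x2\<close> V U \<tau>' \<tau>'_pos V_zeros V_nz])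
    show "G x < \<tau>' x" if "x \<in> {x1<..<x2}" for x
      using T[of x] G_M[of x] \<tau>'_M[of x] M_pos[of x] x_pos[of x] that
      by (metis greaterThanLessThan_iff atLeastAtMost_iff less_imp_le mult_less_cancel_right_pos)
  qed (use \<open>0 < x1\<close> in auto)
  show "\<tau> x2 - \<tau> x1 < pi" if T: "\<And>x. x > 0 \<Longrightarrow> T x > (x / (x + \<sigma>)) ^ (2 * n) * (x + \<sigma>) ^ 4"
  proof (rule sturm_gap_less[OF \<open>x1 < x2\<close> V U \<tau>' \<tau>'_pos V_zeros V_nz])
    show "\<tau>' x < G x" if "x \<in> {x1<..<x2}" for x
      using T[of x] G_M[of x] \<tau>'_M[of x] M_pos[of x] x_pos[of x] that
      by (metis greaterThanLessThan_iff atLeastAtMost_iff less_imp_le mult_less_cancel_right_pos)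
  qed (use \<open>0 < x1\<close> in auto)
qed

section \<open>Gaps between zeros\<close>

lemma lists_positive_zeros_consecutive:
  assumes "lists_positive_zeros j f" "k \<ge> 1"
  shows "0 < j k" "j k < j (k + 1)" "f (j k) = 0" "f (j (k + 1)) = 0"
    "\<And>x. x \<in> {j k<..<j (k + 1)} \<Longrightarrow> f x \<noteq> 0"
proof -
  have mono: "strict_mono_on {1..} j" and img: "j ` {1..} = {x. 0 < x \<and> f x = 0}"
    using assms(1) by (auto simp: lists_positive_zeros_def)
  show "0 < j k" "f (j k) = 0" "f (j (k + 1)) = 0"
    using img \<open>k \<ge> 1\<close> by auto
  show "j k < j (k + 1)"
    using mono \<open>k \<ge> 1\<close> by (auto intro: strict_mono_onD)
  show "f x \<noteq> 0" if x: "x \<in> {j k<..<j (k + 1)}" for x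
  proof
    assume "f x = 0"
    then have "x \<in> j ` {1..}" using img x \<open>0 < j k\<close> by auto
    then obtain i where i: "i \<ge> 1" "x = j i" by auto
    have "k < i" "i < k + 1"
      using x i \<open>k \<ge> 1\<close> strict_mono_on_less[OF mono, of k i] strict_mono_on_less[OF mono, of i "k + 1"]
      by auto
    then show False by simp
  qed
qed

theorem theorem1p4:
  fixes a c d \<sigma> :: real and j :: "nat \<Rightarrow> real"
  assumes "c \<noteq> 0" and "d \<noteq> 0" and "a > -1"
    and "lists_positive_zeros j (\<lambda>x. c * Bessel_J a x + d * Bessel_J (a + 1) x)"
    and "\<sigma> = (2 * a + 1) * c * d / (c\<^sup>2 + d\<^sup>2)"
  shows "(a \<ge> 1/2 \<and> sgn c = sgn d \<longrightarrow>
            (\<forall>k\<ge>1. j (k + 1) - j k > pi)) \<and>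
         (a \<ge> 0 \<and> d\<^sup>2 \<ge> c\<^sup>2 \<and> sgn c = sgn d \<longrightarrow>
            (\<forall>k\<ge>1. \<sigma> * ln (j (k + 1) / j k) + j (k + 1) - j k > pi)) \<and>
         (-1 < a \<and> a < -1/2 \<and> d\<^sup>2 \<ge> c\<^sup>2 \<and> sgn c = - sgn d \<longrightarrow>
            (\<forall>k\<ge>1. j (k + 1) - j k - \<sigma> * ln ((\<sigma> + j (k + 1)) / (\<sigma> + j k)) < pi))"
proof -
  define N where "N = c\<^sup>2 + d\<^sup>2"
  define D where "D = (2 * a + 1) * (c\<^sup>2 - d\<^sup>2) / (2 * N)"
  define w where "w x = c * Bessel_J a x + d * Bessel_J (a + 1) x" for x
  define z where "z x = c * Bessel_J (a + 1) x - d * Bessel_J a x" for x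
  have N_pos: "N > 0" using assms(1) by (simp add: N_def sum_power2_gt_zero_iff)
  have \<sigma>_N: "\<sigma> * N = (2 * a + 1) * c * d" using assms(5) N_pos by (simp add: N_def)
  have D_N: "D * N = (2 * a + 1) * (c\<^sup>2 - d\<^sup>2) / 2" using N_pos by (simp add: D_def)
  \<comment> \<open>Up to scaling, \<open>(w, z)\<close> is a rotation of
    \<open>(J\<^sub>a, J\<^sub>a\<^sub>+\<^sub>1)\<close>. The symmetric traceless part of the
    system, \<open>diag(a + 1/2, -(a + 1/2))\<close> over x, turns into the matrix with rows
    \<open>(D, -\<sigma>)\<close> and \<open>(-\<sigma>, -D)\<close>; its determinant is
    preserved.\<close>
  have \<sigma>D: "\<sigma>\<^sup>2 + D\<^sup>2 = (a + 1/2)\<^sup>2"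
  proof -
    have "(\<sigma>\<^sup>2 + D\<^sup>2) * N\<^sup>2 = (\<sigma> * N)\<^sup>2 + (D * N)\<^sup>2" by algebra
    also have "\<dots> = (a + 1/2)\<^sup>2 * N\<^sup>2" unfolding \<sigma>_N D_N unfolding N_def by (simp add: field_simps power2_eq_square)
    finally show ?thesis using N_pos by simp
  qed
  have w: "(w has_real_derivative (D - 1/2) / x * w x - (1 + \<sigma> / x) * z x) (at x)"
    and z: "(z has_real_derivative (1 - \<sigma> / x) * w x - (D + 1/2) / x * z x) (at x)"
    if "x > 0" for x
  proof -
    let ?u = "Bessel_J a x" and ?v = "Bessel_J (a + 1) x"
    note deriv = has_real_derivative_Bessel_J[OF \<open>a > -1\<close> that]
      has_real_derivative_Bessel_J'[OF \<open>a > -1\<close> that]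
    \<comment> \<open>The coefficients of \<open>?u\<close> and \<open>?v\<close> in
      \<open>(D - 1/2) w - \<sigma> z\<close>. Adding \<open>c\<close> or \<open>d\<close> to them
      yields those for the derivative of \<open>z\<close>.\<close>
    have c: "D * c - \<sigma> * -d - c / 2 = a * c" and d: "D * d - \<sigma> * c - d / 2 = - (a + 1) * d"
    proof -
      have "(D * c - \<sigma> * -d - c / 2) * N = (D * N) * c + (\<sigma> * N) * d - c / 2 * N"
        by (simp add: algebra_simps)
      also have "\<dots> = a * c * N"
        unfolding \<sigma>_N D_N unfolding N_def by (simp add: field_simps power2_eq_square)
      finally show "D * c - \<sigma> * -d - c / 2 = a * c" using N_pos by simp
      have "(D * d - \<sigma> * c - d / 2) * N = (D * N) * d - (\<sigma> * N) * c - d / 2 * N"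
        by (simp add: algebra_simps)
      also have "\<dots> = - (a + 1) * d * N"
        unfolding \<sigma>_N D_N unfolding N_def by (simp add: field_simps power2_eq_square)
      finally show "D * d - \<sigma> * c - d / 2 = - (a + 1) * d" using N_pos by simp
    qed
    have "(D - 1/2) / x * w x - (1 + \<sigma> / x) * z x =
        (D * c - \<sigma> * -d - c / 2) / x * ?u + (D * d - \<sigma> * c - d / 2) / x * ?v - z x"
      using that by (simp add: w_def z_def field_simps)
    also have "\<dots> = c * (a / x * ?u - ?v) + d * (?u - (a + 1) / x * ?v)"
      unfolding c d by (simp add: z_def algebra_simps add_divide_distrib diff_divide_distrib)
    finally show "(w has_real_derivative (D - 1/2) / x * w x - (1 + \<sigma> / x) * z x) (at x)"
      unfolding w_def by (auto intro!: derivative_eq_intros deriv)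
    have "(1 - \<sigma> / x) * w x - (D + 1/2) / x * z x =
        w x + (D * d - \<sigma> * c + d / 2) / x * ?u - (D * c + \<sigma> * d + c / 2) / x * ?v"
      using that by (simp add: w_def z_def field_simps)
    also have "D * d - \<sigma> * c + d / 2 = - a * d" using d by (simp add: algebra_simps)
    also have "D * c + \<sigma> * d + c / 2 = (a + 1) * c" using c by (simp add: algebra_simps)
    also have "w x + (- a * d) / x * ?u - ((a + 1) * c) / x * ?v =
        c * (?u - (a + 1) / x * ?v) - d * (a / x * ?u - ?v)"
      by (simp add: w_def algebra_simps add_divide_distrib diff_divide_distrib)
    finally show "(z has_real_derivative (1 - \<sigma> / x) * w x - (D + 1/2) / x * z x) (at x)"
      unfolding z_def by (auto intro!: derivative_eq_intros deriv)
  qed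
  have j: "lists_positive_zeros j w" using assms(4) by (simp add: w_def[abs_def])
  note consec = lists_positive_zeros_consecutive[OF j]
  show ?thesis
  proof (intro conjI impI allI)
    fix k :: nat
    assume hyp: "1/2 \<le> a \<and> sgn c = sgn d" and k: "1 \<le> k"
    \<comment> \<open>In all three cases \<open>2 * a + 1\<close> and \<open>c * d\<close> have
      equal sign, so \<sigma> is positive and \<open>x + \<sigma>\<close> never vanishes for
      positive x.\<close>
    have "c * d > 0" using hyp assms(1,2) by (auto simp: sgn_if zero_less_mult_iff split: if_splits)
    then have "\<sigma> * N > 0" unfolding \<sigma>_N using hyp by (simp add: mult.assoc)
    then have \<sigma>: "\<sigma> > 0" using N_pos by (simp add: zero_less_mult_iff)
    have ineq: "(x - \<sigma>) * (x + \<sigma>) ^ 3 + D * x * (x + \<sigma>) + (1::nat) * \<sigma> * x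
        - D\<^sup>2 * (x + \<sigma>)\<^sup>2 + (1::nat)\<^sup>2 * \<sigma>\<^sup>2 / 4 < (x / (x + \<sigma>)) ^ (2 * 1) * (x + \<sigma>) ^ 4"
      if "x > 0" for x
    proof -
      \<comment> \<open>Here \<open>a \<ge> 1/2\<close> enters as \<open>M \<ge> 1\<close>: then
        \<open>D < M \<le> M\<^sup>2\<close>. With \<open>D\<^sup>2\<close> eliminated, the
        difference of the two sides is a quadratic in x whose coefficients are all positive.\<close>
      define M where "M = a + 1/2"
      have M: "M \<ge> 1" using hyp by (simp add: M_def)
      have DM: "D\<^sup>2 = M\<^sup>2 - \<sigma>\<^sup>2" using \<sigma>D by (simp add: M_def)
      have "D\<^sup>2 < M\<^sup>2" using DM \<sigma> by simp
      then have "D < M" using M by (meson power2_less_imp_less order_trans zero_le_one)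
      have "M \<le> M\<^sup>2" using M by (simp add: power2_eq_square)
      have "(x / (x + \<sigma>)) ^ (2 * 1) * (x + \<sigma>) ^ 4 = x\<^sup>2 * (x + \<sigma>)\<^sup>2"
        using that \<sigma> by (simp add: power_divide divide_simps power_numeral_reduce)
      moreover have "x\<^sup>2 * (x + \<sigma>)\<^sup>2 - ((x - \<sigma>) * (x + \<sigma>) ^ 3 + D * x * (x + \<sigma>) + \<sigma> * x
          - D\<^sup>2 * (x + \<sigma>)\<^sup>2 + \<sigma>\<^sup>2 / 4) =
          (M\<^sup>2 - D) * x\<^sup>2 + \<sigma> * (2 * M\<^sup>2 - D - 1) * x + \<sigma>\<^sup>2 * (M\<^sup>2 - 1/4)"
        unfolding DM by (simp add: algebra_simps power_numeral_reduce)
      moreover have "(M\<^sup>2 - D) * x\<^sup>2 > 0" "\<sigma> * (2 * M\<^sup>2 - D - 1) * x > 0" "\<sigma>\<^sup>2 * (M\<^sup>2 - 1/4) > 0"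
        using \<open>D < M\<close> \<open>M \<le> M\<^sup>2\<close> M \<sigma> that by (intro mult_pos_pos; simp)+
      ultimately show ?thesis by simp
    qed
    have "((\<lambda>x. x) has_real_derivative (x / (x + \<sigma>)) ^ 1 * (1 + \<sigma> / x)) (at x)" if "x > 0" for x
    proof -
      have "1 + \<sigma> / x = (x + \<sigma>) / x" using that by (simp add: add_divide_distrib)
      then have "(x / (x + \<sigma>)) ^ 1 * (1 + \<sigma> / x) = 1" using that \<sigma> by simp
      then show ?thesis by (metis DERIV_ident)
    qed
    from rotated_Bessel_system_gap_greater[OF _ consec(1,2)[OF k] w z consec(3-5)[OF k] this ineq]
    show "pi < j (k + 1) - j k" using \<sigma> by auto
  next
    fix k :: nat
    assume hyp: "0 \<le> a \<and> c\<^sup>2 \<le> d\<^sup>2 \<and> sgn c = sgn d" and k: "1 \<le> k"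
    have "c * d > 0" using hyp assms(1,2) by (auto simp: sgn_if zero_less_mult_iff split: if_splits)
    then have "\<sigma> * N > 0" unfolding \<sigma>_N using hyp by (simp add: mult.assoc)
    then have \<sigma>: "\<sigma> > 0" using N_pos by (simp add: zero_less_mult_iff)
    \<comment> \<open>With \<open>D \<le> 0\<close>, which is where
      \<open>d\<^sup>2 \<ge> c\<^sup>2\<close> enters, both terms containing \<open>D\<close> help
      the inequality, and \<open>2 * \<sigma> * (x + \<sigma>) ^ 3\<close> makes it strict.\<close>
    have D: "D \<le> 0" using hyp N_pos by (simp add: D_def divide_le_0_iff mult_le_0_iff)
    have ineq: "(x - \<sigma>) * (x + \<sigma>) ^ 3 + D * x * (x + \<sigma>) + (0::nat) * \<sigma> * x
        - D\<^sup>2 * (x + \<sigma>)\<^sup>2 + (0::nat)\<^sup>2 * \<sigma>\<^sup>2 / 4 < (x / (x + \<sigma>)) ^ (2 * 0) * (x + \<sigma>) ^ 4"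
      if "x > 0" for x
    proof -
      have "(x + \<sigma>) ^ 4 - (x - \<sigma>) * (x + \<sigma>) ^ 3 = 2 * \<sigma> * (x + \<sigma>) ^ 3"
        by (simp add: algebra_simps power_numeral_reduce)
      moreover have "2 * \<sigma> * (x + \<sigma>) ^ 3 > 0" using \<sigma> that by simp
      moreover have "D * x * (x + \<sigma>) \<le> 0"
        using D \<sigma> that by (simp add: mult_le_0_iff)
      moreover have "D\<^sup>2 * (x + \<sigma>)\<^sup>2 \<ge> 0" by simp
      ultimately have "(x - \<sigma>) * (x + \<sigma>) ^ 3 + D * x * (x + \<sigma>) - D\<^sup>2 * (x + \<sigma>)\<^sup>2 < (x + \<sigma>) ^ 4"
        by linarith
      then show ?thesis by simp
    qed
    have "((\<lambda>x. x + \<sigma> * ln x) has_real_derivative (x / (x + \<sigma>)) ^ 0 * (1 + \<sigma> / x)) (at x)"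
      if "x > 0" for x
      using that by (auto intro!: derivative_eq_intros)
    from rotated_Bessel_system_gap_greater[OF _ consec(1,2)[OF k] w z consec(3-5)[OF k] this ineq]
    have "pi < j (k + 1) + \<sigma> * ln (j (k + 1)) - (j k + \<sigma> * ln (j k))" using \<sigma> by auto
    then show "pi < \<sigma> * ln (j (k + 1) / j k) + j (k + 1) - j k"
      using consec(1,2)[OF k] by (simp add: ln_div algebra_simps)
  next
    fix k :: nat
    assume hyp: "- 1 < a \<and> a < - 1 / 2 \<and> c\<^sup>2 \<le> d\<^sup>2 \<and> sgn c = - sgn d" and k: "1 \<le> k"
    have "c * d < 0" using hyp assms(1,2) by (auto simp: sgn_if mult_less_0_iff split: if_splits)
    then have "\<sigma> * N > 0" unfolding \<sigma>_N using hyp by (simp add: mult.assoc mult_neg_neg)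
    then have \<sigma>: "\<sigma> > 0" using N_pos by (simp add: zero_less_mult_iff)
    \<comment> \<open>Both \<open>2 * a + 1\<close> and \<open>c\<^sup>2 - d\<^sup>2\<close> are
      nonpositive here, so the sign of \<open>D\<close> is reversed against the previous
      case.\<close>
    have D: "D \<ge> 0" using hyp N_pos unfolding D_def by (intro divide_nonneg_pos mult_nonpos_nonpos) auto
    have ineq: "(x - \<sigma>) * (x + \<sigma>) ^ 3 + D * x * (x + \<sigma>) + (2::nat) * \<sigma> * x
        - D\<^sup>2 * (x + \<sigma>)\<^sup>2 + (2::nat)\<^sup>2 * \<sigma>\<^sup>2 / 4 > (x / (x + \<sigma>)) ^ (2 * 2) * (x + \<sigma>) ^ 4"
      if "x > 0" for x
    proof -
      \<comment> \<open>The range of \<open>a\<close> gives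
        \<open>\<bar>2 * a + 1\<bar> < 1\<close>, which bounds
        \<open>\<sigma>\<^sup>2 + D\<^sup>2\<close> by 1/4. After subtraction of
        \<open>x ^ 4\<close> a cubic remains, with all coefficients nonnegative and a positive
        constant term.\<close>
      have "(a + 1/2)\<^sup>2 < (1/2)\<^sup>2"
        using hyp abs_square_less_1[of "2 * a + 1"] by (simp add: power2_eq_square algebra_simps)
      then have sum: "\<sigma>\<^sup>2 + D\<^sup>2 < 1/4" using \<sigma>D by (simp add: power2_eq_square)
      then have "D\<^sup>2 < 1/4" using zero_le_power2[of \<sigma>] by linarith
      then have "D\<^sup>2 < (1/2)\<^sup>2" by (simp add: power2_eq_square)
      then have "D < 1/2" by (rule power2_less_imp_less) simp
      have "(x / (x + \<sigma>)) ^ (2 * 2) * (x + \<sigma>) ^ 4 = x ^ 4"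
        using that \<sigma> by (simp add: power_divide)
      moreover have "(x - \<sigma>) * (x + \<sigma>) ^ 3 + D * x * (x + \<sigma>) + 2 * \<sigma> * x
          - D\<^sup>2 * (x + \<sigma>)\<^sup>2 + 4 * \<sigma>\<^sup>2 / 4 - x ^ 4 =
          2 * \<sigma> * x ^ 3 + D * (1 - D) * x\<^sup>2 + \<sigma> * (2 - 2 * (\<sigma>\<^sup>2 + D\<^sup>2) + D) * x
          + \<sigma>\<^sup>2 * (1 - (\<sigma>\<^sup>2 + D\<^sup>2))"
        by (simp add: algebra_simps power_numeral_reduce)
      moreover have "2 * \<sigma> * x ^ 3 > 0" "D * (1 - D) * x\<^sup>2 \<ge> 0" "\<sigma>\<^sup>2 * (1 - (\<sigma>\<^sup>2 + D\<^sup>2)) > 0"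
        using \<sigma> D \<open>D < 1/2\<close> sum that by auto
      moreover have "\<sigma> * (2 - 2 * (\<sigma>\<^sup>2 + D\<^sup>2) + D) * x > 0"
        using \<sigma> D sum that by (intro mult_pos_pos) auto
      ultimately show ?thesis by simp
    qed
    have "((\<lambda>x. x - \<sigma> * ln (\<sigma> + x)) has_real_derivative (x / (x + \<sigma>)) ^ 2 * (1 + \<sigma> / x)) (at x)"
      if "x > 0" for x
    proof -
      have "(x / (x + \<sigma>)) ^ 2 * (1 + \<sigma> / x) = 1 - \<sigma> * (1 / (\<sigma> + x))"
        using that \<sigma> by (simp add: divide_simps) (simp add: algebra_simps power2_eq_square)
      then show ?thesis
        using that \<sigma> by (auto intro!: derivative_eq_intros)
    qed
    from rotated_Bessel_system_gap_less[OF _ consec(1,2)[OF k] w z consec(3-5)[OF k] this ineq]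
    have "j (k + 1) - \<sigma> * ln (\<sigma> + j (k + 1)) - (j k - \<sigma> * ln (\<sigma> + j k)) < pi" using \<sigma> by auto
    then show "j (k + 1) - j k - \<sigma> * ln ((\<sigma> + j (k + 1)) / (\<sigma> + j k)) < pi"
      using consec(1,2)[OF k] \<sigma> by (simp add: ln_div algebra_simps)
  qed
qed

end
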